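(* Let $\lambda_1,\lambda_2>0$, and for $f:\mathbb{Z}\to\mathbb{R}$ define $$\mathcal{A}[f(k)]=\lambda_1 f(k+1)-k f(k)-\lambda_2 f(k-1),\qquad k\in\mathbb{Z}.$$ Then $\mathcal{A}$ is a Stein operator for the $\mathrm{Skellam}(\lambda_1,\lambda_2)$ distribution; that is, for an integer-valued random variable $W$, $$\mathbb{E}\,\mathcal{A}[f(W)]=0 \text{ for every bounded function } f:\mathbb{Z}\to\mathbb{R}\quad\text{if and only if}\quad W\sim \mathrm{Skellam}(\lambda_1,\lambda_2).$$
   Context: For $\lambda_1,\lambda_2>0$, an integer-valued random variable $W$ has the $\mathrm{Skellam}(\lambda_1,\lambda_2)$ distribution if $\mathbb{P}(W=k)=e^{-(\lambda_1+\lambda_2)}\left(\sqrt{\lambda_1/\lambda_2}\right)^k I_k(2\sqrt{\lambda_1\lambda_2})$ for $k\in\mathbb{Z}$, where $I_k$ is the modified Bessel function of the first kind of index $k$. Equivalently, $W$ has the law of the difference of two independent Poisson random variables with means $\lambda_1$ and $\lambda_2$. Here $\mathcal{A}[f(W)]$ means $\lambda_1 f(W+1)-Wf(W)-\lambda_2 f(W-1)$. *)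

theory Defs
  imports "HOL-Probability.Probability"
begin

(* Modified Bessel function of the first kind of integer index. As rGamma = 1 / Gamma vanishes at
   the non-positive integers, negative indices need no separate treatment. *)
definition bessel_I :: "int \<Rightarrow> real \<Rightarrow> real" where
  "bessel_I k x =
     (\<Sum>m. rGamma (real_of_int (k + int m + 1)) / fact m * (x / 2) powi (2 * int m + k))"

definition skellam_mass :: "real \<Rightarrow> real \<Rightarrow> int \<Rightarrow> real" where
  "skellam_mass l1 l2 k =
     exp (- (l1 + l2)) * sqrt (l1 / l2) powi k * bessel_I k (2 * sqrt (l1 * l2))"

definition has_skellam_dist :: "'a measure \<Rightarrow> ('a \<Rightarrow> int) \<Rightarrow> real \<Rightarrow> real \<Rightarrow> bool" where
  "has_skellam_dist M W l1 l2 \<longleftrightarrow>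
     (\<forall>k. measure M {\<omega> \<in> space M. W \<omega> = k} = skellam_mass l1 l2 k)"

definition skellam_stein_op :: "real \<Rightarrow> real \<Rightarrow> (int \<Rightarrow> real) \<Rightarrow> int \<Rightarrow> real" where
  "skellam_stein_op l1 l2 f k = l1 * f (k + 1) - real_of_int k * f k - l2 * f (k - 1)"

(* The Bochner integral of a non-integrable function is 0 by convention, so a vanishing
   expectation must include its existence. *)
definition has_zero_expectation :: "'a measure \<Rightarrow> ('a \<Rightarrow> real) \<Rightarrow> bool" where
  "has_zero_expectation M X \<longleftrightarrow> integrable M X \<and> integral\<^sup>L M X = 0"

end

theory Submission
  imports Defs
begin

text \<open>
  Let \<open>p\<close> be the mass function of \<open>W\<close>. Tested on the indicator of \<open>{k}\<close>, the Stein identity reads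
  \<open>k p(k) = l1 p(k - 1) - l2 p(k + 1)\<close>. Conversely, a probability mass function satisfying this
  recurrence satisfies the Stein identity for every bounded \<open>f\<close>, by summation by parts
  (\<open>has_sum_stein_op_of_recurrence\<close>). The claim is therefore that the Skellam mass function \<open>q\<close> is the
  only probability mass function on the integers that solves the recurrence.

  It solves it because it is the convolution of the \<open>Poisson(l1)\<close> and the reflected \<open>Poisson(l2)\<close>
  masses: the Bessel series is that convolution, term by term
  (\<open>skellam_mass_has_sum_convolution\<close>), and the recurrences \<open>n P(n) = l P(n - 1)\<close> of the two
  Poisson masses combine to that of \<open>q\<close>.

  The solutions of a second-order recurrence form a two-dimensional space, so uniqueness needs the
  decay of \<open>p\<close>. The Casoratian \<open>p(k) q(k + 1) - p(k + 1) q(k)\<close> gets multiplied by \<open>- l1 / l2\<close>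
  when \<open>k\<close> increases by one. Its modulus thus fails to decrease in at least one of the two
  directions, while summability of \<open>p\<close> and \<open>q\<close> makes it tend to 0 in both. Hence it vanishes, \<open>p\<close>
  is a multiple of the positive function \<open>q\<close>, and the total masses fix the factor.
\<close>

section \<open>Expectations of functions of an integer-valued random variable\<close>

text \<open>
  Unconditional summability of a real family is absolute summability, which is why a single
  \<open>has_sum\<close> expresses both the existence of the expectation and its value.
\<close>
lemma expectation_eq_iff_has_sum:
  fixes W :: "'a \<Rightarrow> int" and g :: "int \<Rightarrow> real"
  assumes "prob_space M" and W [measurable]: "W \<in> measurable M (count_space UNIV)"
  defines "p \<equiv> \<lambda>k. measure M {\<omega> \<in> space M. W \<omega> = k}"
  shows "integrable M (\<lambda>\<omega>. g (W \<omega>)) \<and> (LINT \<omega>|M. g (W \<omega>)) = s \<longleftrightarrow>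
    ((\<lambda>k. p k * g k) has_sum s) UNIV"
proof -
  interpret prob_space M by fact
  have p_nonneg: "p k \<ge> 0" for k by (simp add: p_def)
  have distr: "distr M (count_space UNIV) W = density (count_space UNIV) (\<lambda>k. ennreal (p k))"
  proof (rule measure_eqI_countable[where A = UNIV])
    fix k :: int
    have "emeasure (distr M (count_space UNIV) W) {k} = emeasure M (W -` {k} \<inter> space M)"
      by (simp add: emeasure_distr)
    also have "W -` {k} \<inter> space M = {\<omega> \<in> space M. W \<omega> = k}"
      by auto
    also have "emeasure M {\<omega> \<in> space M. W \<omega> = k} = ennreal (p k)"
      by (simp add: p_def emeasure_eq_measure)
    also have "\<dots> = emeasure (density (count_space UNIV) (\<lambda>k. ennreal (p k))) {k}"
      by (simp add: emeasure_density nn_integral_count_space_indicator[symmetric]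
            nn_integral_count_space_finite)
    finally show "emeasure (distr M (count_space UNIV) W) {k} =
        emeasure (density (count_space UNIV) (\<lambda>k. ennreal (p k))) {k}" .
  qed auto
  have "integrable M (\<lambda>\<omega>. g (W \<omega>)) \<longleftrightarrow> integrable (distr M (count_space UNIV) W) g"
    by (subst integrable_distr_eq) auto
  also have "\<dots> \<longleftrightarrow> integrable (count_space UNIV) (\<lambda>k. p k * g k)"
    unfolding distr by (subst integrable_density) (auto simp: p_nonneg)
  also have "\<dots> \<longleftrightarrow> (\<lambda>k. p k * g k) summable_on UNIV"
    by (metis summable_on_iff_abs_summable_on_real abs_summable_equivalent abs_summable_on_def)
  finally have integrable: "integrable M (\<lambda>\<omega>. g (W \<omega>)) \<longleftrightarrow> (\<lambda>k. p k * g k) summable_on UNIV" .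
  have integral: "(LINT \<omega>|M. g (W \<omega>)) = infsum (\<lambda>k. p k * g k) UNIV"
    if sum: "(\<lambda>k. p k * g k) summable_on UNIV"
  proof -
    have "(LINT \<omega>|M. g (W \<omega>)) = (LINT k|distr M (count_space UNIV) W. g k)"
      by (subst integral_distr) auto
    also have "\<dots> = (LINT k|count_space UNIV. p k * g k)"
      unfolding distr by (subst integral_density) (auto simp: p_nonneg)
    also have "\<dots> = infsetsum (\<lambda>k. p k * g k) UNIV"
      by (simp add: infsetsum_def)
    also have "\<dots> = infsum (\<lambda>k. p k * g k) UNIV"
      using sum
      by (metis summable_on_iff_abs_summable_on_real abs_summable_equivalent infsetsum_infsum)
    finally show ?thesis .
  qed
  show ?thesis
    unfolding integrable
    using integral by (metis has_sum_infsum has_sum_imp_summable infsumI)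
qed

section \<open>The Skellam recurrence\<close>

definition skellam_recurrence :: "real \<Rightarrow> real \<Rightarrow> (int \<Rightarrow> real) \<Rightarrow> bool" where
  "skellam_recurrence l1 l2 p \<longleftrightarrow> (\<forall>k. of_int k * p k = l1 * p (k - 1) - l2 * p (k + 1))"

lemma has_sum_shift_int:
  fixes c :: int
  shows "((\<lambda>k. f (k + c)) has_sum s) UNIV \<longleftrightarrow> (f has_sum s) UNIV"
  by (rule has_sum_reindex_bij_witness[where i = "\<lambda>k. k - c" and j = "\<lambda>k. k + c"]) auto

lemma has_sum_int_iff_nat:
  fixes f :: "int \<Rightarrow> real"
  assumes "\<And>n. n < 0 \<Longrightarrow> f n = 0"
  shows "(f has_sum s) UNIV \<longleftrightarrow> ((\<lambda>n. f (int n)) has_sum s) UNIV"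
proof -
  have "n < 0" if "n \<notin> range int" for n :: int
    using that by (metis nonneg_int_cases not_le rangeI)
  hence "(f has_sum s) UNIV \<longleftrightarrow> (f has_sum s) (range int)"
    by (intro has_sum_cong_neutral) (auto simp: assms)
  thus ?thesis by (simp add: has_sum_reindex o_def)
qed

lemma has_sum_diff:
  fixes f g :: "'a \<Rightarrow> real"
  assumes "(f has_sum a) A" and "(g has_sum b) A"
  shows "((\<lambda>x. f x - g x) has_sum (a - b)) A"
  using has_sum_add[OF assms(1) has_sum_uminusI[OF assms(2)]] by simp

text \<open>
  The Stein operator of the indicator of \<open>{n}\<close> is supported on \<open>{n - 1, n, n + 1}\<close>, so the
  series is a finite sum, and it is the recurrence at \<open>n\<close>.
\<close>
lemma skellam_recurrence_of_indicator:
  fixes p :: "int \<Rightarrow> real"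
  assumes "\<And>n. ((\<lambda>k. p k * skellam_stein_op l1 l2 (indicator {n}) k) has_sum 0) UNIV"
  shows "skellam_recurrence l1 l2 p"
  unfolding skellam_recurrence_def
proof
  fix n :: int
  let ?g = "\<lambda>k. p k * skellam_stein_op l1 l2 (indicator {n}) k"
  have "(?g has_sum 0) UNIV \<longleftrightarrow> (?g has_sum 0) {n - 1, n, n + 1}"
    by (rule has_sum_cong_neutral) (auto simp: skellam_stein_op_def indicator_def)
  hence "sum ?g {n - 1, n, n + 1} = 0"
    using assms[of n] by (meson finite.intros has_sum_finite has_sum_unique)
  thus "of_int n * p n = l1 * p (n - 1) - l2 * p (n + 1)"
    by (simp add: skellam_stein_op_def indicator_def algebra_simps)
qed

text \<open>
  Boundedness of \<open>f\<close> only makes the two shift terms of the Stein operator summable against \<open>p\<close>. The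
  middle term \<open>k f(k) p(k)\<close>, whose factor \<open>k\<close> is unbounded, is a difference of shifts of these two by
  the recurrence; hence it is summable too, and the total telescopes to 0.
\<close>
lemma has_sum_stein_op_of_recurrence:
  fixes p f :: "int \<Rightarrow> real"
  assumes p: "\<And>k. p k \<ge> 0" "p summable_on UNIV"
    and rec: "skellam_recurrence l1 l2 p" and f: "bounded (range f)"
  shows "((\<lambda>k. p k * skellam_stein_op l1 l2 f k) has_sum 0) UNIV"
proof -
  obtain B where B: "\<And>k. \<bar>f k\<bar> \<le> B"
    using f by (auto simp: bounded_iff)
  have summable: "(\<lambda>k. p k * f (k + c)) summable_on UNIV" for c
  proof (rule abs_summable_summable, rule Infinite_Sum.abs_summable_on_comparison_test')
    show "(\<lambda>k. p k * B) summable_on UNIV"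
      using p by (intro summable_on_cmult_left)
  qed (simp add: abs_mult p B mult_left_mono)
  define up where "up k = l1 * (p k * f (k + 1))" for k
  define down where "down k = l2 * (p k * f (k - 1))" for k
  have "up summable_on UNIV" "down summable_on UNIV"
    unfolding up_def down_def
    using summable[of 1] summable[of "- 1"] by (auto intro!: summable_on_cmult_right)
  then obtain a b where a: "(up has_sum a) UNIV" and b: "(down has_sum b) UNIV"
    unfolding summable_on_def by blast
  have "((\<lambda>k. up k - (up (k + (- 1)) - down (k + 1)) - down k) has_sum (a - (a - b) - b)) UNIV"
    by (intro has_sum_diff has_sum_shift_int[THEN iffD2] a b)
  moreover have "up k - (up (k + (- 1)) - down (k + 1)) - down k
      = p k * skellam_stein_op l1 l2 f k" for k
  proof -
    have "up (k + (- 1)) - down (k + 1) = (of_int k * p k) * f k"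
      unfolding rec[unfolded skellam_recurrence_def, rule_format]
      by (simp add: up_def down_def algebra_simps)
    thus ?thesis
      by (simp add: skellam_stein_op_def up_def down_def algebra_simps)
  qed
  ultimately show ?thesis by simp
qed

lemma summable_on_int_tendsto_0:
  fixes p :: "int \<Rightarrow> real"
  assumes "p summable_on UNIV" and "inj h"
  shows "(\<lambda>n::nat. p (h n)) \<longlonglongrightarrow> 0"
proof -
  have "p summable_on range h"
    using assms(1) by (rule summable_on_subset_banach) simp
  hence "(\<lambda>n. p (h n)) summable_on UNIV"
    using assms(2) by (simp add: summable_on_reindex o_def)
  thus ?thesis
    by (intro summable_LIMSEQ_zero summable_on_imp_summable)
qed

text \<open>
  A discrete Wronskian argument: the Casoratian \<open>C\<close> of two solutions satisfies the first-order
  recurrence \<open>l2 C(k + 1) = - l1 C(k)\<close>. If it were nonzero at some \<open>k\<close>, its modulus would stay at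
  least \<open>\<bar>C(k)\<bar>\<close> to the right of \<open>k\<close> when \<open>l1 \<ge> l2\<close>, and to the left of \<open>k\<close> otherwise, although it
  tends to 0 both ways.
\<close>
lemma skellam_recurrence_casoratian_eq_0:
  fixes p q :: "int \<Rightarrow> real"
  assumes l: "l1 > 0" "l2 > 0"
    and p: "p summable_on UNIV" "skellam_recurrence l1 l2 p"
    and q: "q summable_on UNIV" "skellam_recurrence l1 l2 q"
  shows "p k * q (k + 1) = p (k + 1) * q k"
proof -
  define C where "C k = p k * q (k + 1) - p (k + 1) * q k" for k
  have step: "l2 * C (k + 1) = - l1 * C k" for k
  proof -
    have pq: "l2 * p (k + 1 + 1) = l1 * p k - of_int (k + 1) * p (k + 1)"
      "l2 * q (k + 1 + 1) = l1 * q k - of_int (k + 1) * q (k + 1)"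
      using p(2) q(2) unfolding skellam_recurrence_def by (smt (verit) add_diff_cancel_right')+
    have "p (k + 1) * (l2 * q (k + 1 + 1)) - (l2 * p (k + 1 + 1)) * q (k + 1)
        = p (k + 1) * (l1 * q k) - (l1 * p k) * q (k + 1)"
      unfolding pq by (simp add: algebra_simps)
    thus ?thesis by (simp add: C_def algebra_simps)
  qed
  have C_tendsto: "(\<lambda>n. C (h n)) \<longlonglongrightarrow> 0" if h: "inj h" for h :: "nat \<Rightarrow> int"
  proof -
    have "inj (\<lambda>n. h n + 1)" using h by (simp add: inj_def)
    hence "(\<lambda>n. C (h n)) \<longlonglongrightarrow> 0 * 0 - 0 * 0"
      unfolding C_def using h p(1) q(1) by (intro tendsto_intros summable_on_int_tendsto_0)
    thus ?thesis by simp
  qed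
  have "C k = 0"
  proof (rule ccontr)
    assume nz: "C k \<noteq> 0"
    have abs_step: "l2 * \<bar>C (j + 1)\<bar> = l1 * \<bar>C j\<bar>" for j
      using arg_cong[OF step[of j], of abs] l by (simp add: abs_mult)
    \<comment> \<open>\<open>h\<close> runs from \<open>k\<close> to \<open>+\<infinity>\<close> or to \<open>-\<infinity>\<close>, a direction in which \<open>\<bar>C\<bar>\<close> does not decrease.\<close>
    obtain h :: "nat \<Rightarrow> int" where h: "inj h" "\<And>n. \<bar>C (h n)\<bar> \<ge> \<bar>C k\<bar>"
    proof (cases "l1 \<ge> l2")
      case True
      have "\<bar>C (j + 1)\<bar> \<ge> \<bar>C j\<bar>" for j
      proof -
        have "l2 * \<bar>C j\<bar> \<le> l1 * \<bar>C j\<bar>"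
          using True by (intro mult_right_mono) auto
        thus ?thesis using abs_step[of j] l by (metis mult_le_cancel_left_pos)
      qed
      hence "\<bar>C (k + int n)\<bar> \<ge> \<bar>C k\<bar>" for n
      proof (induction n)
        case (Suc n)
        thus ?case
          using Suc.prems[of "k + int n"] by (simp add: ac_simps)
      qed simp
      thus ?thesis
        by (intro that[of "\<lambda>n. k + int n"]) (auto simp: inj_def)
    next
      case False
      have "\<bar>C j\<bar> \<ge> \<bar>C (j + 1)\<bar>" for j
      proof -
        have "l1 * \<bar>C j\<bar> \<le> l2 * \<bar>C j\<bar>"
          using False by (intro mult_right_mono) auto
        thus ?thesis using abs_step[of j] l by (metis mult_le_cancel_left_pos)
      qed
      hence "\<bar>C (k - int n)\<bar> \<ge> \<bar>C k\<bar>" for n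
      proof (induction n)
        case (Suc n)
        thus ?case
          using Suc.prems[of "k - int n - 1"] by (simp add: algebra_simps)
      qed simp
      thus ?thesis
        by (intro that[of "\<lambda>n. k - int n"]) (auto simp: inj_def)
    qed
    have "(\<lambda>n. \<bar>C (h n)\<bar>) \<longlonglongrightarrow> 0"
      using C_tendsto[OF h(1)] by (rule tendsto_rabs_zero)
    hence "\<bar>C k\<bar> \<le> 0"
      by (rule Lim_bounded2) (use h(2) in auto)
    thus False using nz by simp
  qed
  thus ?thesis by (simp add: C_def)
qed

lemma skellam_recurrence_unique:
  fixes p q :: "int \<Rightarrow> real"
  assumes l: "l1 > 0" "l2 > 0"
    and p: "(p has_sum 1) UNIV" "skellam_recurrence l1 l2 p"
    and q: "(q has_sum 1) UNIV" "skellam_recurrence l1 l2 q" "\<And>k. q k > 0"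
  shows "p = q"
proof -
  have step: "p (k + 1) / q (k + 1) = p k / q k" for k
    using skellam_recurrence_casoratian_eq_0[OF l has_sum_imp_summable p(2)
        has_sum_imp_summable q(2), OF p(1) q(1), of k] q(3)[of k] q(3)[of "k + 1"]
    by (simp add: field_simps)
  have ratio: "p k / q k = p 0 / q 0" for k
  proof (induction k rule: int_induct[where k = 0])
    case (step1 i)
    thus ?case using step[of i] by simp
  next
    case (step2 i)
    thus ?case using step[of "i - 1"] by simp
  qed simp
  define c where "c = p 0 / q 0"
  have p_eq: "p k = c * q k" for k
    using ratio[of k] q(3)[of k] by (simp add: c_def field_simps)
  have "(p has_sum c * 1) UNIV"
    unfolding p_eq using q(1) by (rule has_sum_cmult_right)
  hence "c = 1" using p(1) by (simp add: has_sum_unique)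
  thus ?thesis using p_eq by auto
qed

section \<open>The Skellam mass function as a Poisson convolution\<close>

text \<open>
  Extending the Poisson masses by 0 to all integers makes index shifts bijections, so that
  no boundary terms arise in the convolution.
\<close>
definition poisson_mass :: "real \<Rightarrow> int \<Rightarrow> real" where
  "poisson_mass l n = (if n < 0 then 0 else exp (- l) * l ^ nat n / fact (nat n))"

lemma poisson_mass_nonneg: "l > 0 \<Longrightarrow> poisson_mass l n \<ge> 0"
  by (simp add: poisson_mass_def)

text \<open>At \<open>n = 0\<close> both sides vanish, thanks to the extension by 0.\<close>
lemma poisson_mass_recurrence: "of_int n * poisson_mass l n = l * poisson_mass l (n - 1)"
proof (cases "n > 0")
  case True
  then obtain m where "n = int (Suc m)"
    by (metis gr0_implies_Suc zero_less_imp_eq_int)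
  thus ?thesis
    by (simp add: poisson_mass_def nat_add_distrib divide_simps)
qed (auto simp: poisson_mass_def)

lemma poisson_mass_has_sum_1:
  assumes "l > 0"
  shows "(poisson_mass l has_sum 1) UNIV"
proof -
  have "(\<lambda>n. exp (- l) * (l ^ n /\<^sub>R fact n)) sums (exp (- l) * exp l)"
    by (intro sums_mult exp_converges)
  moreover have "exp (- l) * exp l = 1" by (simp flip: exp_add)
  ultimately have "((\<lambda>n. exp (- l) * (l ^ n /\<^sub>R fact n)) has_sum 1) UNIV"
    using assms by (intro sums_nonneg_imp_has_sum) auto
  also have "(\<lambda>n. exp (- l) * (l ^ n /\<^sub>R fact n)) = poisson_mass l \<circ> int"
    by (auto simp: poisson_mass_def field_simps)
  finally show ?thesis
    by (subst has_sum_int_iff_nat) (auto simp: poisson_mass_def o_def)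
qed

lemma poisson_mass_le_1:
  assumes "l > 0"
  shows "poisson_mass l n \<le> 1"
  using finite_sum_le_has_sum[OF poisson_mass_has_sum_1[OF assms], of "{n}"]
  by (simp add: poisson_mass_nonneg[OF assms])

text \<open>
  The terms with \<open>k + m < 0\<close> vanish on both sides, as \<open>rGamma\<close> does at the non-positive integers. In
  the others, the half-integer powers of \<open>l1\<close> and \<open>l2\<close> coming from the two square roots combine to
  \<open>l1 ^ (k + m) * l2 ^ m\<close>.
\<close>
lemma poisson_mass_prod_eq_bessel_term:
  assumes l: "l1 > 0" "l2 > 0"
  shows "poisson_mass l1 (k + int m) * poisson_mass l2 (int m) =
    exp (- (l1 + l2)) * sqrt (l1 / l2) powi k *
      (rGamma (real_of_int (k + int m + 1)) / fact m
        * (2 * sqrt (l1 * l2) / 2) powi (2 * int m + k))"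
proof (cases "k + int m < 0")
  case True
  hence "rGamma (real_of_int (k + int m + 1)) = 0"
    by (subst rGamma_of_int) auto
  thus ?thesis using True by (simp add: poisson_mass_def)
next
  case False
  then obtain n where n: "k + int m = int n"
    using nonneg_int_cases by (metis linorder_not_less)
  hence k: "k = int n - int m" by simp
  define s t where "s = sqrt l1" and "t = sqrt l2"
  have st: "s > 0" "t > 0" "l1 = s\<^sup>2" "l2 = t\<^sup>2"
    using l by (auto simp: s_def t_def)
  have "rGamma (real_of_int (k + int m + 1)) = inverse (fact n)"
    by (subst rGamma_of_int) (simp add: n)
  moreover have "sqrt (l1 / l2) = s / t" "2 * sqrt (l1 * l2) / 2 = s * t"
    using l by (simp_all add: s_def t_def real_sqrt_divide real_sqrt_mult)
  moreover have "(s / t) powi k * (s * t) powi (2 * int m + k) = s ^ (2 * n) * t ^ (2 * m)"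
  proof -
    have "(s / t) powi k * (s * t) powi (2 * int m + k)
        = (s powi k * s powi (2 * int m + k)) * (t powi (2 * int m + k) / t powi k)"
      by (simp add: power_int_mult_distrib power_int_divide_distrib)
    also have "s powi k * s powi (2 * int m + k) = s powi (k + (2 * int m + k))"
      using st by (subst power_int_add) auto
    also have "k + (2 * int m + k) = int (2 * n)" by (simp add: k)
    also have "t powi (2 * int m + k) / t powi k = t powi (2 * int m + k - k)"
      using st by (subst power_int_diff) auto
    also have "2 * int m + k - k = int (2 * m)" by simp
    finally show ?thesis by (simp only: power_int_of_nat)
  qed
  ultimately have "exp (- (l1 + l2)) * sqrt (l1 / l2) powi k *
      (rGamma (real_of_int (k + int m + 1)) / fact m
        * (2 * sqrt (l1 * l2) / 2) powi (2 * int m + k))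
      = exp (- (l1 + l2)) * (inverse (fact n) / fact m) * (s ^ (2 * n) * t ^ (2 * m))"
    by (metis (no_types, opaque_lifting) mult.assoc mult.left_commute)
  also have "\<dots> = poisson_mass l1 (k + int m) * poisson_mass l2 (int m)"
    unfolding n by (simp add: poisson_mass_def st(3,4) exp_diff exp_minus field_simps exp_add
        flip: power_mult)
  finally show ?thesis ..
qed

lemma skellam_mass_has_sum_convolution:
  assumes l: "l1 > 0" "l2 > 0"
  shows "((\<lambda>m. poisson_mass l1 (k + m) * poisson_mass l2 m) has_sum skellam_mass l1 l2 k) UNIV"
proof -
  let ?f = "\<lambda>m. poisson_mass l1 (k + m) * poisson_mass l2 m"
  have "?f summable_on UNIV"
    using has_sum_imp_summable[OF poisson_mass_has_sum_1[OF l(2)]]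
    by (rule summable_on_comparison_test)
      (auto intro!: mult_left_le_one_le mult_nonneg_nonneg
        simp: poisson_mass_nonneg poisson_mass_le_1 l)
  then obtain S where S: "(?f has_sum S) UNIV" by (auto simp: summable_on_def)
  from S have "(\<lambda>m. ?f (int m)) sums S"
    by (subst (asm) has_sum_int_iff_nat) (auto simp: poisson_mass_def intro: has_sum_imp_sums)
  moreover define c where "c = exp (- (l1 + l2)) * sqrt (l1 / l2) powi k"
  moreover have "c \<noteq> 0" using l by (simp add: c_def)
  ultimately have "(\<lambda>m. rGamma (real_of_int (k + int m + 1)) / fact m
        * (2 * sqrt (l1 * l2) / 2) powi (2 * int m + k)) sums (S / c)"
    unfolding poisson_mass_prod_eq_bessel_term[OF l] by (auto dest: sums_divide[where c = c])
  hence "bessel_I k (2 * sqrt (l1 * l2)) = S / c"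
    unfolding bessel_I_def by (rule sums_unique[symmetric])
  hence "skellam_mass l1 l2 k = S"
    using \<open>c \<noteq> 0\<close> by (simp add: skellam_mass_def c_def)
  thus ?thesis using S by simp
qed

lemma skellam_mass_pos:
  assumes l: "l1 > 0" "l2 > 0"
  shows "skellam_mass l1 l2 k > 0"
proof -
  \<comment> \<open>the least index at which both Poisson masses in the convolution are positive\<close>
  define m where "m = max 0 (- k)"
  have "0 < poisson_mass l1 (k + m) * poisson_mass l2 m"
    using l by (simp add: m_def poisson_mass_def)
  also have "\<dots> \<le> skellam_mass l1 l2 k"
    using finite_sum_le_has_sum[OF skellam_mass_has_sum_convolution[OF l, of k], of "{m}"] l
    by (simp add: poisson_mass_nonneg)
  finally show ?thesis .
qed

text \<open>
  The double series of the convolution has nonnegative terms. Summed first over \<open>k\<close>, it is the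
  product of the two Poisson totals.
\<close>
lemma skellam_mass_has_sum_1:
  assumes l: "l1 > 0" "l2 > 0"
  shows "(skellam_mass l1 l2 has_sum 1) UNIV"
proof -
  define F where "F k m = poisson_mass l1 (k + m) * poisson_mass l2 m" for k m
  have inner: "((\<lambda>k. F k m) has_sum poisson_mass l2 m) UNIV" for m
    using has_sum_cmult_left[of "\<lambda>k. poisson_mass l1 (k + m)" UNIV 1 "poisson_mass l2 m"]
      poisson_mass_has_sum_1[OF l(1)]
    by (simp add: F_def has_sum_shift_int)
  have "((\<lambda>(m, k). F k m) has_sum 1) (UNIV \<times> UNIV)"
  proof (rule has_sum_SigmaI)
    show "(\<lambda>(m, k). F k m) summable_on UNIV \<times> UNIV"
      by (rule summable_on_SigmaI[where g = "poisson_mass l2"])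
        (use inner has_sum_imp_summable[OF poisson_mass_has_sum_1[OF l(2)]]
          in \<open>auto simp: F_def poisson_mass_nonneg l\<close>)
  qed (use inner poisson_mass_has_sum_1[OF l(2)] in auto)
  also have "?this \<longleftrightarrow> ((\<lambda>(k, m). F k m) has_sum 1) (UNIV \<times> UNIV)"
    by (rule has_sum_reindex_bij_witness[where i = prod.swap and j = prod.swap]) auto
  finally show ?thesis
    by (rule has_sum_SigmaD) (use skellam_mass_has_sum_convolution[OF l] in \<open>simp add: F_def\<close>)
qed

text \<open>
  In each term of the convolution, write the factor \<open>k\<close> as \<open>(k + m) - m\<close> and apply the Poisson
  recurrences to \<open>(k + m) P(k + m)\<close> and \<open>m Q(m)\<close>.
\<close>
lemma skellam_mass_recurrence:
  assumes l: "l1 > 0" "l2 > 0"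
  shows "skellam_recurrence l1 l2 (skellam_mass l1 l2)"
  unfolding skellam_recurrence_def
proof
  fix k :: int
  let ?P = "poisson_mass l1" and ?Q = "poisson_mass l2" and ?q = "skellam_mass l1 l2"
  note conv = skellam_mass_has_sum_convolution[OF l]
  have up: "((\<lambda>m. l1 * (?P (k - 1 + m) * ?Q m)) has_sum l1 * ?q (k - 1)) UNIV"
    by (intro has_sum_cmult_right conv)
  have "((\<lambda>m. l2 * (?P (k + 1 + (m + (- 1))) * ?Q (m + (- 1)))) has_sum l2 * ?q (k + 1)) UNIV"
    by (subst has_sum_shift_int) (intro has_sum_cmult_right conv)
  hence "((\<lambda>m. l1 * (?P (k - 1 + m) * ?Q m) - l2 * (?P (k + m) * ?Q (m - 1)))
      has_sum (l1 * ?q (k - 1) - l2 * ?q (k + 1))) UNIV"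
    using up by (intro has_sum_diff) (simp_all add: algebra_simps)
  moreover have "l1 * (?P (k - 1 + m) * ?Q m) - l2 * (?P (k + m) * ?Q (m - 1))
      = of_int k * (?P (k + m) * ?Q m)" for m
  proof -
    have "l1 * (?P (k - 1 + m) * ?Q m) - l2 * (?P (k + m) * ?Q (m - 1))
        = (l1 * ?P (k + m - 1)) * ?Q m - ?P (k + m) * (l2 * ?Q (m - 1))"
      by (simp add: algebra_simps)
    also have "\<dots> = of_int k * (?P (k + m) * ?Q m)"
      unfolding poisson_mass_recurrence[symmetric] by (simp add: algebra_simps)
    finally show ?thesis .
  qed
  ultimately have "((\<lambda>m. of_int k * (?P (k + m) * ?Q m))
      has_sum (l1 * ?q (k - 1) - l2 * ?q (k + 1))) UNIV"
    by simp
  moreover have "((\<lambda>m. of_int k * (?P (k + m) * ?Q m)) has_sum of_int k * ?q k) UNIV"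
    by (intro has_sum_cmult_right conv)
  ultimately show "of_int k * ?q k = l1 * ?q (k - 1) - l2 * ?q (k + 1)"
    by (metis has_sum_unique)
qed

section \<open>The Stein characterisation\<close>

theorem theorem1:
  fixes M :: "'a measure" and W :: "'a \<Rightarrow> int" and l1 l2 :: real
  assumes "l1 > 0" and "l2 > 0"
    and "prob_space M"
    and "W \<in> measurable M (count_space UNIV)"
  shows "(\<forall>f :: int \<Rightarrow> real. bounded (range f) \<longrightarrow>
            has_zero_expectation M (\<lambda>\<omega>. skellam_stein_op l1 l2 f (W \<omega>)))
         \<longleftrightarrow> has_skellam_dist M W l1 l2"
proof -
  define p where "p k = measure M {\<omega> \<in> space M. W \<omega> = k}" for k
  note l = assms(1,2)
  note expectation = expectation_eq_iff_has_sum[OF assms(3,4), folded p_def]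
  have dist: "has_skellam_dist M W l1 l2 \<longleftrightarrow> p = skellam_mass l1 l2"
    by (auto simp: has_skellam_dist_def p_def fun_eq_iff)
  show ?thesis
    unfolding dist has_zero_expectation_def expectation
  proof
    assume stein: "\<forall>f :: int \<Rightarrow> real. bounded (range f) \<longrightarrow>
      ((\<lambda>k. p k * skellam_stein_op l1 l2 f k) has_sum 0) UNIV"
    have "bounded (range (indicator {n} :: int \<Rightarrow> real))" for n
      by (rule boundedI[where B = 1]) (auto simp: indicator_def)
    hence rec: "skellam_recurrence l1 l2 p"
      using stein by (intro skellam_recurrence_of_indicator) blast
    have "((\<lambda>k. p k * 1) has_sum 1) UNIV"
      by (rule expectation[THEN iffD1]) (simp add: prob_space.prob_space assms(3)
          finite_measure.integrable_const prob_space.finite_measure)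
    thus "p = skellam_mass l1 l2"
      using rec skellam_mass_has_sum_1 skellam_mass_recurrence skellam_mass_pos l
      by (intro skellam_recurrence_unique[OF l]) auto
  next
    assume "p = skellam_mass l1 l2"
    thus "\<forall>f :: int \<Rightarrow> real. bounded (range f) \<longrightarrow>
      ((\<lambda>k. p k * skellam_stein_op l1 l2 f k) has_sum 0) UNIV"
      using skellam_mass_has_sum_1 skellam_mass_recurrence skellam_mass_pos l
      by (auto intro!: has_sum_stein_op_of_recurrence intro: has_sum_imp_summable less_imp_le)
  qed
qed

end
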